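(* Let $n\ge 1$, $k\in\{1,\dots,n\}$, $r:=\binom{n}{k}$, and let $A:[0,\infty)\to\mathbb{R}^{n\times n}$ be continuous. If there exist $\eta>0$ and a vector norm $|\cdot|$ on $\mathbb{R}^r$, with induced matrix measure $\mu:\mathbb{R}^{r\times r}\to\mathbb{R}$, such that $$\mu\big(A^{[k]}(t)\big)\le -\eta\quad\text{for all } t\ge 0,$$ then the linear time-varying system $\dot w(t)=A(t)w(t)$ is $k$-contractive.
   Context: For $M\in\mathbb{R}^{n\times m}$ and $1\le k\le\min\{n,m\}$, the $k$th multiplicative compound $M^{(k)}$ is the $\binom{n}{k}\times\binom{m}{k}$ matrix of all $k\times k$ minors of $M$, with row index sets and column index sets (increasing $k$-sequences) ordered lexicographically. For $M\in\mathbb{R}^{n\times n}$, the $k$th additive compound is $M^{[k]}:=\frac{d}{d\varepsilon}(I+\varepsilon M)^{(k)}\big|_{\varepsilon=0}\in\mathbb{R}^{r\times r}$, $r=\binom{n}{k}$; and $A^{[k]}(t):=(A(t))^{[k]}$. For a vector norm $|\cdot|$ on $\mathbb{R}^q$ with induced matrix norm $\|M\|:=\max_{|x|=1}|Mx|$, the induced matrix measure is $\mu(M):=\lim_{\varepsilon\downarrow 0}\frac{\|I+\varepsilon M\|-1}{\varepsilon}$. Let $w(t,a)$ denote the solution at time $t$ of $\dot w=A(t)w$ with $w(0)=a$. The system $\dot w=A(t)w$ is called $k$-contractive if there exist $\eta>0$ and a vector norm $|\cdot|$ (on $\mathbb{R}^r$) such that for any $a^1,\dots,a^k\in\mathbb{R}^n$,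 the matrix $W(t):=\begin{bmatrix} w(t,a^1)&\dots&w(t,a^k)\end{bmatrix}\in\mathbb{R}^{n\times k}$ satisfies $|W^{(k)}(t)|\le \exp(-\eta t)\,|W^{(k)}(0)|$ for all $t\ge 0$. *)

theory Defs
  imports
    "HOL-Analysis.Derivative"
    "HOL-Library.List_Lexorder"
    "Jordan_Normal_Form.Determinant"
begin

text \<open>
  Matrices and vectors are indexed from 0, so the increasing \<open>k\<close>-sequences have entries in
  \<open>{..<n}\<close>. The order on \<^typ>\<open>nat list\<close> is the lexicographic one.
\<close>

definition index_seqs :: "nat \<Rightarrow> nat \<Rightarrow> nat list list" where
  "index_seqs n k = sorted_list_of_set {I. length I = k \<and> sorted_wrt (<) I \<and> set I \<subseteq> {..<n}}"

definition kminor :: "'a :: comm_ring_1 mat \<Rightarrow> nat list \<Rightarrow> nat list \<Rightarrow> 'a" where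
  "kminor M I J = det (mat (length I) (length J) (\<lambda>(p, q). M $$ (I ! p, J ! q)))"

definition mult_compound :: "nat \<Rightarrow> 'a :: comm_ring_1 mat \<Rightarrow> 'a mat" where
  "mult_compound k M =
     mat (dim_row M choose k) (dim_col M choose k)
       (\<lambda>(i, j). kminor M (index_seqs (dim_row M) k ! i) (index_seqs (dim_col M) k ! j))"

text \<open>The derivative is taken entrywise; each entry is a polynomial in \<open>\<epsilon>\<close>.\<close>

definition add_compound :: "nat \<Rightarrow> real mat \<Rightarrow> real mat" where
  "add_compound k M =
     mat (dim_row M choose k) (dim_row M choose k)
       (\<lambda>(i, j). deriv (\<lambda>\<epsilon>. mult_compound k (1\<^sub>m (dim_row M) + \<epsilon> \<cdot>\<^sub>m M) $$ (i, j)) 0)"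

definition is_vector_norm :: "nat \<Rightarrow> (real vec \<Rightarrow> real) \<Rightarrow> bool" where
  "is_vector_norm q N \<longleftrightarrow>
     (\<forall>x \<in> carrier_vec q. 0 \<le> N x) \<and>
     (\<forall>x \<in> carrier_vec q. N x = 0 \<longleftrightarrow> x = 0\<^sub>v q) \<and>
     (\<forall>c. \<forall>x \<in> carrier_vec q. N (c \<cdot>\<^sub>v x) = \<bar>c\<bar> * N x) \<and>
     (\<forall>x \<in> carrier_vec q. \<forall>y \<in> carrier_vec q. N (x + y) \<le> N x + N y)"

text \<open>
  For a norm \<open>N\<close> on a space of dimension \<open>q \<ge> 1\<close> the supremum is attained, the unit sphere
  being nonempty and compact.
\<close>

definition induced_norm :: "nat \<Rightarrow> (real vec \<Rightarrow> real) \<Rightarrow> real mat \<Rightarrow> real" where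
  "induced_norm q N M = (SUP x \<in> {x \<in> carrier_vec q. N x = 1}. N (M *\<^sub>v x))"

text \<open>
  For a norm \<open>N\<close> and \<open>q \<ge> 1\<close> the limit exists: the difference quotient is nondecreasing in
  \<open>\<epsilon> > 0\<close> and bounded below.
\<close>

definition matrix_measure :: "nat \<Rightarrow> (real vec \<Rightarrow> real) \<Rightarrow> real mat \<Rightarrow> real" where
  "matrix_measure q N M =
     Lim (at_right 0) (\<lambda>\<epsilon>. (induced_norm q N (1\<^sub>m q + \<epsilon> \<cdot>\<^sub>m M) - 1) / \<epsilon>)"

text \<open>
  The function \<open>w\<close> solves \<open>w' = A(t) w\<close>, \<open>w(0) = a\<close>, on \<open>[0, \<infinity>)\<close>; the derivative at \<open>t = 0\<close>
  is one-sided. For continuous \<open>A\<close> there is exactly one solution on \<open>[0, \<infinity>)\<close>.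
\<close>

definition is_solution ::
    "nat \<Rightarrow> (real \<Rightarrow> real mat) \<Rightarrow> real vec \<Rightarrow> (real \<Rightarrow> real vec) \<Rightarrow> bool" where
  "is_solution n A a w \<longleftrightarrow>
     w 0 = a \<and>
     (\<forall>t \<ge> 0. w t \<in> carrier_vec n) \<and>
     (\<forall>t \<ge> 0. \<forall>i < n.
        ((\<lambda>s. w s $ i) has_real_derivative (A t *\<^sub>v w t) $ i) (at t within {0..}))"

text \<open>
  The compound of an \<open>n \<times> k\<close> matrix has a single column, whose norm is taken.
\<close>

definition k_contractive :: "nat \<Rightarrow> nat \<Rightarrow> (real \<Rightarrow> real mat) \<Rightarrow> bool" where
  "k_contractive n k A \<longleftrightarrow>
     (\<exists>\<eta> N. 0 < \<eta> \<and> is_vector_norm (n choose k) N \<and>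
       (\<forall>a w.
          (\<forall>j < k. a j \<in> carrier_vec n \<and> is_solution n A (a j) (w j)) \<longrightarrow>
          (let W = (\<lambda>t. mat n k (\<lambda>(i, j). w j t $ i)) in
           \<forall>t \<ge> 0. N (col (mult_compound k (W t)) 0)
                   \<le> exp (- \<eta> * t) * N (col (mult_compound k (W 0)) 0))))"

end

theory Submission
  imports Defs "HOL-Analysis.Function_Topology"
begin

text \<open>
  The compound \<open>y = W\<^sup>(\<^sup>k\<^sup>)\<close> of a matrix solution of \<open>W' = A W\<close> solves the linear system
  \<open>y' = A\<^sup>[\<^sup>k\<^sup>] y\<close>, a consequence of the Cauchy-Binet formula. For a solution of \<open>y' = B y\<close> one has
  \<open>N (y (t + h)) \<le> \<parallel>I + h B(t)\<parallel> N (y t) + o(h)\<close>, so the upper right Dini derivative of \<open>N (y t)\<close>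
  is at most \<open>\<mu>(B(t)) N (y t) \<le> - \<eta> N (y t)\<close>, and \<open>exp (\<eta> t) N (y t)\<close> is nonincreasing.
\<close>

section \<open>The Cauchy-Binet formula\<close>

text \<open>The operators \<open>deriv\<close>, \<open>SUP\<close> and \<open>Lim\<close> in the
  definitions are total, so their values carry information only once differentiability, boundedness
  or convergence is known. Much of the work supplies just this: minors are polynomial in the
  entries; the supremum in \<open>induced_norm\<close> is finite because \<open>N\<close> dominates
  a multiple of the l1 norm, by compactness; the quotient in \<open>matrix_measure\<close> is
  monotone and bounded below. No entry of the additive compound is ever computed. Cauchy-Binet makes
  a minor of \<open>(I + \<epsilon> A) W\<close> a linear combination of minors of \<open>W\<close>,
  with coefficients whose derivatives at \<open>0\<close> are the entries of the additive compound
  by definition. An arbitrary norm need not be differentiable along a solution, hence the one-sided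
  growth estimates. The given \<open>\<eta>\<close> and \<open>N\<close> themselves witness
  contractivity.\<close>

lemma set_index_seqs:
  "set (index_seqs n k) = {I. length I = k \<and> sorted_wrt (<) I \<and> set I \<subseteq> {..<n}}"
  and distinct_index_seqs: "distinct (index_seqs n k)"
  and length_index_seqs: "length (index_seqs n k) = n choose k"
proof -
  let ?S = "{I. length I = k \<and> sorted_wrt (<) I \<and> set I \<subseteq> {..<n}}"
  have "finite {I. set I \<subseteq> {..<n} \<and> length I = k}"
    by (rule finite_lists_length_eq) simp
  then have fin: "finite ?S"
    by (rule rev_finite_subset) auto
  show "set (index_seqs n k) = ?S" "distinct (index_seqs n k)"
    using fin by (simp_all add: index_seqs_def)
  have "bij_betw set ?S {K. K \<subseteq> {..<n} \<and> card K = k}"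
  proof (rule bij_betwI[where g = sorted_list_of_set])
    show "set \<in> ?S \<rightarrow> {K. K \<subseteq> {..<n} \<and> card K = k}"
      by (auto simp: strict_sorted_iff distinct_card)
    show "sorted_list_of_set \<in> {K. K \<subseteq> {..<n} \<and> card K = k} \<rightarrow> ?S"
    proof
      fix K assume "K \<in> {K. K \<subseteq> {..<n} \<and> card K = k}"
      then show "sorted_list_of_set K \<in> ?S"
        using finite_subset[of K "{..<n}"] by simp
    qed
    show "sorted_list_of_set (set I) = I" if "I \<in> ?S" for I
      using that by (intro sorted_distinct_set_unique) (auto simp: strict_sorted_iff)
    show "set (sorted_list_of_set K) = K" if "K \<in> {K. K \<subseteq> {..<n} \<and> card K = k}" for K
      using that finite_subset[of K "{..<n}"] by simp
  qed
  then have "card ?S = card {K. K \<subseteq> {..<n} \<and> card K = k}"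
    by (rule bij_betw_same_card)
  also have "\<dots> = n choose k"
    using n_subsets[of "{..<n}" k] by simp
  finally have "card ?S = n choose k" .
  then show "length (index_seqs n k) = n choose k"
    by (simp add: index_seqs_def)
qed

lemma index_seqs_nth:
  assumes "i < n choose k"
  shows "index_seqs n k ! i \<in> set (index_seqs n k)"
  using assms by (simp add: length_index_seqs)

text \<open>There is just \<open>k choose k = 1\<close> such sequence, and it must exhaust
  \<open>{..<k}\<close>. Hence the compound of an \<open>n\<close> by \<open>k\<close> matrix is one
  column, made of the minors on the columns \<open>[0..<k]\<close>.\<close>

lemma index_seqs_self: "index_seqs k k = [[0..<k]]"
proof -
  have "length (index_seqs k k) = 1"
    by (simp add: length_index_seqs)
  then obtain I where I: "index_seqs k k = [I]"
    by (cases "index_seqs k k") auto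
  then have "I \<in> set (index_seqs k k)"
    by simp
  then have len: "length I = k" and sorted: "sorted_wrt (<) I" and sub: "set I \<subseteq> {..<k}"
    by (simp_all add: set_index_seqs)
  have "card (set I) = card {..<k}"
    using distinct_card[of I] sorted len by (simp add: strict_sorted_iff)
  then have "set I = {..<k}"
    by (rule card_subset_eq[OF finite_lessThan sub])
  then have "I = [0..<k]"
    using strict_sorted_equal[OF sorted, of "[0..<k]"] by (simp add: lessThan_atLeast0)
  then show ?thesis
    using I by simp
qed

lemma det_leibniz:
  "det (mat k k (\<lambda>(p, q). f p q)) =
     (\<Sum>\<sigma> | \<sigma> permutes {0..<k}. signof \<sigma> * (\<Prod>p = 0..<k. f p (\<sigma> p)))"
  by (subst det_def'[of _ k])
    (auto intro!: sum.cong prod.cong arg_cong2[of _ _ _ _ "(*)"]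
      dest: permutes_in_image[THEN iffD2])

text \<open>Multilinearity in the rows: row \<open>p\<close> combines the rows \<open>b j\<close>
  with coefficients \<open>c p j\<close>, and distributing the product over the sums chooses one
  index \<open>f p\<close> for each row.\<close>

lemma det_sum_rows:
  assumes "finite S"
  shows "det (mat k k (\<lambda>(p, q). \<Sum>j\<in>S. c p j * b j q)) =
    (\<Sum>f\<in>{0..<k} \<rightarrow>\<^sub>E S. (\<Prod>p = 0..<k. c p (f p)) * det (mat k k (\<lambda>(p, q). b (f p) q)))"
proof -
  have "(\<Sum>\<sigma> | \<sigma> permutes {0..<k}. signof \<sigma> * (\<Prod>p = 0..<k. \<Sum>j\<in>S. c p j * b j (\<sigma> p))) =
    (\<Sum>\<sigma> | \<sigma> permutes {0..<k}. \<Sum>f\<in>{0..<k} \<rightarrow>\<^sub>E S.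
       (\<Prod>p = 0..<k. c p (f p)) * (signof \<sigma> * (\<Prod>p = 0..<k. b (f p) (\<sigma> p))))"
    using assms
    by (simp add: prod_sum_PiE prod.distrib sum_distrib_left mult.left_commute)
  then show ?thesis
    by (simp add: det_leibniz sum_distrib_left)
      (rule sum.swap)
qed

text \<open>Every permutation hits column \<open>q\<close>, so each Leibniz product has a zero
  factor.\<close>

lemma det_rows_zero_col:
  assumes "q < k" "\<And>p. p < k \<Longrightarrow> f p q = 0"
  shows "det (mat k k (\<lambda>(p, q). f p q)) = 0"
proof -
  have "(\<Prod>p = 0..<k. f p (\<sigma> p)) = 0" if \<sigma>: "\<sigma> permutes {0..<k}" for \<sigma>
  proof -
    have "q \<in> \<sigma> ` {0..<k}"
      using assms(1) permutes_image[OF \<sigma>] by simp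
    then obtain p where "p \<in> {0..<k}" "\<sigma> p = q" by blast
    then show ?thesis
      using assms(2) by (intro prod_zero bexI[of _ p]) auto
  qed
  then show ?thesis
    by (simp add: det_leibniz)
qed

text \<open>If \<open>f\<close> repeats an index, both sides vanish. Otherwise only the sorted image
  of \<open>f\<close> contributes, and its Kronecker determinant is the sign of the permutation that
  sorts \<open>f\<close>. Kept as a determinant, this coefficient does not involve \<open>b\<close>
  and reappears verbatim when minors of the left factor of a product are expanded.\<close>

lemma det_select_rows:
  fixes b :: "nat \<Rightarrow> nat \<Rightarrow> 'a :: comm_ring_1"
  assumes f: "f \<in> {0..<k} \<rightarrow> {0..<n}"
  shows "det (mat k k (\<lambda>(p, q). b (f p) q)) =
    (\<Sum>J\<in>set (index_seqs n k).
       det (mat k k (\<lambda>(p, q). if f p = J ! q then 1 else 0)) * det (mat k k (\<lambda>(p, q). b (J ! p) q)))"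
proof (cases "inj_on f {0..<k}")
  case False
  then obtain i j where ij: "i < k" "j < k" "i \<noteq> j" "f i = f j"
    by (auto simp: inj_on_def)
  have "det (mat k k (\<lambda>(p, q). c (f p) q)) = 0" for c :: "nat \<Rightarrow> nat \<Rightarrow> 'a"
    by (rule det_identical_rows[OF _ ij(3,1,2)]) (use ij in \<open>auto intro: eq_vecI\<close>)
  from this[of b] this[of "\<lambda>i q. if i = J ! q then 1 else 0" for J] show ?thesis
    by simp
next
  case inj: True
  define J where "J = sorted_list_of_set (f ` {0..<k})"
  have set_J: "set J = f ` {0..<k}" and len_J: "length J = k" and "sorted_wrt (<) J"
    using inj by (simp_all add: J_def card_image)
  then have J: "J \<in> set (index_seqs n k)"
    using f by (auto simp: set_index_seqs)
  have dist: "distinct J"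
    using \<open>sorted_wrt (<) J\<close> by (simp add: strict_sorted_iff)
  \<comment> \<open>\<open>\<sigma> i\<close> is the position of \<open>f i\<close> in
    \<open>J\<close>; \<open>permutes\<close> demands the identity outside
    \<open>{0..<k}\<close>.\<close>
  define \<sigma> where "\<sigma> i = (if i \<in> {0..<k} then inv_into {0..<k} ((!) J) (f i) else i)" for i
  have bJ: "bij_betw ((!) J) {0..<k} (f ` {0..<k})"
    using bij_betw_nth[OF dist] len_J set_J by (simp add: lessThan_atLeast0)
  have "bij_betw (inv_into {0..<k} ((!) J) \<circ> f) {0..<k} {0..<k}"
    by (rule bij_betw_trans[OF inj_on_imp_bij_betw[OF inj] bij_betw_inv_into[OF bJ]])
  then have "bij_betw \<sigma> {0..<k} {0..<k}"
    by (rule bij_betw_cong[THEN iffD1, rotated]) (simp add: \<sigma>_def)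
  then have \<sigma>: "\<sigma> permutes {0..<k}"
    by (rule bij_imp_permutes) (auto simp: \<sigma>_def)
  have J\<sigma>: "J ! \<sigma> p = f p" if "p < k" for p
    using that bij_betw_inv_into_right[OF bJ, of "f p"] by (simp add: \<sigma>_def)
  have sel: "det (mat k k (\<lambda>(p, q). c (f p) q)) = signof \<sigma> * det (mat k k (\<lambda>(p, q). c (J ! p) q))"
    for c :: "nat \<Rightarrow> nat \<Rightarrow> 'a"
  proof -
    have "mat k k (\<lambda>(p, q). c (f p) q) =
        mat k k (\<lambda>(i, j). mat k k (\<lambda>(p, q). c (J ! p) q) $$ (\<sigma> i, j))"
      using permutes_in_image[OF \<sigma>] by (intro eq_matI) (auto simp: J\<sigma>)
    then show ?thesis
      using det_permute_rows[OF _ \<sigma>, of "mat k k (\<lambda>(p, q). c (J ! p) q)"] by simp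
  qed
  have "mat k k (\<lambda>(p, q). if J ! p = J ! q then 1 else 0) = (1\<^sub>m k :: 'a mat)"
    using dist len_J by (intro eq_matI) (auto simp: nth_eq_iff_index_eq)
  then have diag: "det (mat k k (\<lambda>(p, q). if f p = J ! q then 1 else 0)) = (signof \<sigma> :: 'a)"
    using sel[of "\<lambda>i q. if i = J ! q then 1 else 0"] by simp
  have off: "det (mat k k (\<lambda>(p, q). if f p = K ! q then 1 else 0)) = (0 :: 'a)"
    if K: "K \<in> set (index_seqs n k)" and "K \<noteq> J" for K
  proof -
    have "set K \<noteq> set J"
      using K J \<open>K \<noteq> J\<close> sorted_distinct_set_unique[of K J]
      by (auto simp: set_index_seqs strict_sorted_iff)
    moreover have "card (set K) = card (set J)"
      using K J by (simp add: set_index_seqs distinct_card strict_sorted_iff)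
    \<comment> \<open>A different set of equal size cannot lie inside \<open>set J\<close>. An entry
      \<open>K ! q\<close> outside the image of \<open>f\<close> then makes column \<open>q\<close>
      zero.\<close>
    ultimately have "\<not> set K \<subseteq> set J"
      using card_subset_eq[of "set J" "set K"] by auto
    then obtain x where "x \<in> set K" "x \<notin> set J" by blast
    then obtain q where "q < k" "K ! q \<notin> f ` {0..<k}"
      using K set_J by (metis (mono_tags, lifting) in_set_conv_nth mem_Collect_eq set_index_seqs)
    then show ?thesis
      by (intro det_rows_zero_col[of q]) (auto simp: image_iff dest: sym)
  qed
  have "(\<Sum>K\<in>set (index_seqs n k).
       det (mat k k (\<lambda>(p, q). if f p = K ! q then 1 else 0)) * det (mat k k (\<lambda>(p, q). b (K ! p) q))) =
    signof \<sigma> * det (mat k k (\<lambda>(p, q). b (J ! p) q))"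
    by (subst sum.remove[OF _ J]) (auto simp: diag off)
  then show ?thesis
    by (simp add: sel)
qed

text \<open>Both sides are expanded over all maps \<open>f\<close> from row positions to summation
  indices. Regrouping by \<open>det_select_rows\<close> leaves only an exchange of two sums.\<close>

lemma cauchy_binet:
  fixes A B :: "'a :: comm_ring_1 mat"
  assumes A: "A \<in> carrier_mat m n" and B: "B \<in> carrier_mat n l"
    and I: "length I = k" "set I \<subseteq> {..<m}" and L: "length L = k" "set L \<subseteq> {..<l}"
  shows "kminor (A * B) I L = (\<Sum>J\<in>set (index_seqs n k). kminor A I J * kminor B J L)"
proof -
  let ?F = "{0..<k} \<rightarrow>\<^sub>E {0..<n}"
  let ?\<delta> = "\<lambda>f J. det (mat k k (\<lambda>(p, q). if f p = J ! q then 1 else 0)) :: 'a"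
  have nI: "I ! p < m" if "p < k" for p
    using that I by (auto simp: subset_iff)
  have nL: "L ! p < l" if "p < k" for p
    using that L by (auto simp: subset_iff)
  \<comment> \<open>Writing an entry of \<open>A\<close> as a sum against a Kronecker delta expands
    its minors over the same maps \<open>f\<close> as the minors of the product.\<close>
  have minor_A: "kminor A I J = (\<Sum>f\<in>?F. (\<Prod>p = 0..<k. A $$ (I ! p, f p)) * ?\<delta> f J)"
    if J: "J \<in> set (index_seqs n k)" for J
  proof -
    have nJ: "J ! q < n" if "q < k" for q
      using that J by (auto simp: set_index_seqs subset_iff)
    have "kminor A I J = det (mat k k (\<lambda>(p, q).
        \<Sum>j\<in>{0..<n}. A $$ (I ! p, j) * (if j = J ! q then 1 else 0)))"
      unfolding kminor_def using I J
      by (intro arg_cong[of _ _ det] cong_mat)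
        (auto simp: set_index_seqs nJ if_distrib[of "(*) _"] cong: if_cong)
    also have "\<dots> = (\<Sum>f\<in>?F. (\<Prod>p = 0..<k. A $$ (I ! p, f p)) * ?\<delta> f J)"
      by (rule det_sum_rows) simp
    finally show ?thesis .
  qed
  have "kminor (A * B) I L =
      det (mat k k (\<lambda>(p, q). \<Sum>j\<in>{0..<n}. A $$ (I ! p, j) * B $$ (j, L ! q)))"
    unfolding kminor_def using A B I L
    by (intro arg_cong[of _ _ det] cong_mat) (auto simp: nI nL scalar_prod_def)
  also have "\<dots> = (\<Sum>f\<in>?F. (\<Prod>p = 0..<k. A $$ (I ! p, f p)) *
      (\<Sum>J\<in>set (index_seqs n k). ?\<delta> f J * kminor B J L))"
    unfolding det_sum_rows[OF finite_atLeastLessThan]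
  proof (intro sum.cong refl arg_cong2[of _ _ _ _ "(*)"])
    fix f assume "f \<in> ?F"
    then have "f \<in> {0..<k} \<rightarrow> {0..<n}" by (simp add: PiE_def)
    then show "det (mat k k (\<lambda>(p, q). B $$ (f p, L ! q))) =
        (\<Sum>J\<in>set (index_seqs n k). ?\<delta> f J * kminor B J L)"
      by (subst det_select_rows[of f k n "\<lambda>i q. B $$ (i, L ! q)"])
        (simp_all add: kminor_def L set_index_seqs)
  qed
  also have "\<dots> = (\<Sum>J\<in>set (index_seqs n k). kminor A I J * kminor B J L)"
    by (simp add: minor_A sum_distrib_left sum_distrib_right mult.assoc)
      (rule sum.swap)
  finally show ?thesis .
qed

section \<open>Compounds of matrix solutions\<close>

text \<open>The differential of the determinant at \<open>X\<close> in direction \<open>Y\<close>.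
  What matters is that it depends on a curve only through its value and velocity; the sum is never
  evaluated.\<close>

definition det_deriv :: "nat \<Rightarrow> (nat \<Rightarrow> nat \<Rightarrow> real) \<Rightarrow> (nat \<Rightarrow> nat \<Rightarrow> real) \<Rightarrow> real" where
  "det_deriv k X Y = (\<Sum>\<sigma> | \<sigma> permutes {0..<k}.
     signof \<sigma> * (\<Sum>p\<in>{0..<k}. Y p (\<sigma> p) * (\<Prod>r\<in>{0..<k} - {p}. X r (\<sigma> r))))"

lemma has_real_derivative_prod_within:
  fixes f :: "'b \<Rightarrow> real \<Rightarrow> real"
  assumes "\<And>p. p \<in> P \<Longrightarrow> (f p has_real_derivative f' p) (at x within S)"
  shows "((\<lambda>u. \<Prod>p\<in>P. f p u) has_real_derivative
    (\<Sum>p\<in>P. f' p * (\<Prod>r\<in>P - {p}. f r x))) (at x within S)"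
  using assms
proof (induction P rule: infinite_finite_induct)
  case (insert q P)
  have eq: "insert q P - {p} = insert q (P - {p})" if "p \<in> P" for p
    using insert.hyps that by auto
  show ?case
    using insert.hyps
    by (auto intro!: derivative_eq_intros insert.prems insert.IH sum.cong
        simp: sum_distrib_left sum_distrib_right eq)
qed auto

lemma has_real_derivative_det:
  assumes "\<And>p q. p < k \<Longrightarrow> q < k \<Longrightarrow> ((\<lambda>s. X s p q) has_real_derivative Y p q) (at x within S)"
  shows "((\<lambda>s. det (mat k k (\<lambda>(p, q). X s p q))) has_real_derivative det_deriv k (X x) Y)
    (at x within S)"
  unfolding det_leibniz det_deriv_def
proof (intro DERIV_sum DERIV_cmult has_real_derivative_prod_within assms)
  fix \<sigma> p
  assume "\<sigma> \<in> {\<sigma>. \<sigma> permutes {0..<k}}" "p \<in> {0..<k}"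
  then show "p < k" "\<sigma> p < k"
    using permutes_in_image[of \<sigma> "{0..<k}" p] by auto
qed

lemma has_real_derivative_kminor:
  assumes "\<And>i j. i < m \<Longrightarrow> j < l \<Longrightarrow> ((\<lambda>s. X s $$ (i, j)) has_real_derivative Y i j) (at x within S)"
    and I: "length I = k" "set I \<subseteq> {..<m}" and L: "length L = k" "set L \<subseteq> {..<l}"
  shows "((\<lambda>s. kminor (X s) I L) has_real_derivative
    det_deriv k (\<lambda>p q. X x $$ (I ! p, L ! q)) (\<lambda>p q. Y (I ! p) (L ! q))) (at x within S)"
  unfolding kminor_def I(1) L(1)
proof (rule has_real_derivative_det)
  fix p q assume "p < k" "q < k"
  then have "I ! p < m" "L ! q < l"
    using I L by (auto simp: subset_iff)
  then show "((\<lambda>s. X s $$ (I ! p, L ! q)) has_real_derivative Y (I ! p) (L ! q)) (at x within S)"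
    by (rule assms(1))
qed

text \<open>
  To first order \<open>W (x + h)\<close> is \<open>(1 + h A) W x\<close>, and by Cauchy-Binet the minors of the latter are
  linear in those of \<open>W x\<close>; hence the two functions of \<open>h\<close> have the same derivative at \<open>0\<close>.
\<close>

lemma has_real_derivative_kminor_ode:
  fixes A :: "real mat" and W :: "real \<Rightarrow> real mat"
  assumes A: "A \<in> carrier_mat n n" and W: "\<And>s. W s \<in> carrier_mat n l"
    and deriv: "\<And>i j. i < n \<Longrightarrow> j < l \<Longrightarrow>
      ((\<lambda>s. W s $$ (i, j)) has_real_derivative (A * W x) $$ (i, j)) (at x within S)"
    and I: "I \<in> set (index_seqs n k)" and L: "length L = k" "set L \<subseteq> {..<l}"
  shows "((\<lambda>s. kminor (W s) I L) has_real_derivative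
    (\<Sum>J\<in>set (index_seqs n k). deriv (\<lambda>\<epsilon>. kminor (1\<^sub>m n + \<epsilon> \<cdot>\<^sub>m A) I J) 0 * kminor (W x) J L))
    (at x within S)"
proof -
  note idx = set_index_seqs[of n k]
  let ?P = "\<lambda>\<epsilon>. 1\<^sub>m n + \<epsilon> \<cdot>\<^sub>m A"
  let ?D = "det_deriv k (\<lambda>p q. W x $$ (I ! p, L ! q)) (\<lambda>p q. (A * W x) $$ (I ! p, L ! q))"
  have I': "length I = k" "set I \<subseteq> {..<n}"
    using I by (auto simp: idx)
  have P: "?P \<epsilon> \<in> carrier_mat n n" for \<epsilon>
    using A by simp
  have PW: "(?P \<epsilon> * W x) $$ (i, j) = W x $$ (i, j) + \<epsilon> * (A * W x) $$ (i, j)"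
    if "i < n" "j < l" for i j \<epsilon>
  proof -
    have "?P \<epsilon> * W x = W x + \<epsilon> \<cdot>\<^sub>m (A * W x)"
      using A W[of x] by (simp add: add_mult_distrib_mat[of _ n n] mult_smult_assoc_mat[of _ n n])
    then show ?thesis
      using that A W[of x] by simp
  qed
  \<comment> \<open>At \<open>0\<close> this curve has value \<open>W x\<close> and velocity
    \<open>A * W x\<close>, the same data as \<open>W\<close> at \<open>x\<close>, so its minor has
    the same derivative \<open>?D\<close>.\<close>
  have "((\<lambda>\<epsilon>. kminor (?P \<epsilon> * W x) I L) has_real_derivative
      det_deriv k (\<lambda>p q. (?P 0 * W x) $$ (I ! p, L ! q)) (\<lambda>p q. (A * W x) $$ (I ! p, L ! q))) (at 0)"
  proof (rule has_real_derivative_kminor[OF _ I' L])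
    fix i j assume "i < n" "j < l"
    then show "((\<lambda>\<epsilon>. (?P \<epsilon> * W x) $$ (i, j)) has_real_derivative (A * W x) $$ (i, j)) (at 0)"
      by (auto simp: PW intro!: derivative_eq_intros)
  qed
  moreover have "?P 0 * W x = W x"
    using PW[of _ _ 0] A W[of x] by (intro eq_matI) auto
  ultimately have 1: "((\<lambda>\<epsilon>. kminor (?P \<epsilon> * W x) I L) has_real_derivative ?D) (at 0)"
    by simp
  \<comment> \<open>Differentiability has to be shown before \<open>deriv\<close> denotes the
    derivative.\<close>
  have minor: "((\<lambda>\<epsilon>. kminor (?P \<epsilon>) I J) has_real_derivative deriv (\<lambda>\<epsilon>. kminor (?P \<epsilon>) I J) 0) (at 0)"
    if J: "J \<in> set (index_seqs n k)" for J
  proof -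
    have "((\<lambda>\<epsilon>. ?P \<epsilon> $$ (i, j)) has_real_derivative A $$ (i, j)) (at 0)" if "i < n" "j < n" for i j
      using that A by (auto intro!: derivative_eq_intros)
    then have "((\<lambda>\<epsilon>. kminor (?P \<epsilon>) I J) has_real_derivative
        det_deriv k (\<lambda>p q. ?P 0 $$ (I ! p, J ! q)) (\<lambda>p q. A $$ (I ! p, J ! q))) (at 0)"
      using J by (intro has_real_derivative_kminor[OF _ I', where l = n]) (simp_all add: idx)
    then show ?thesis
      by (metis DERIV_imp_deriv)
  qed
  have "((\<lambda>\<epsilon>. \<Sum>J\<in>set (index_seqs n k). kminor (?P \<epsilon>) I J * kminor (W x) J L) has_real_derivative
      (\<Sum>J\<in>set (index_seqs n k). deriv (\<lambda>\<epsilon>. kminor (?P \<epsilon>) I J) 0 * kminor (W x) J L)) (at 0)"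
    by (intro DERIV_sum DERIV_cmult_right minor)
  then have "((\<lambda>\<epsilon>. kminor (?P \<epsilon> * W x) I L) has_real_derivative
      (\<Sum>J\<in>set (index_seqs n k). deriv (\<lambda>\<epsilon>. kminor (?P \<epsilon>) I J) 0 * kminor (W x) J L)) (at 0)"
    by (simp add: cauchy_binet[OF P W I' L])
  then have "?D = (\<Sum>J\<in>set (index_seqs n k). deriv (\<lambda>\<epsilon>. kminor (?P \<epsilon>) I J) 0 * kminor (W x) J L)"
    using 1 by (rule DERIV_unique[symmetric])
  then show ?thesis
    using has_real_derivative_kminor[OF deriv I' L] by simp
qed

text \<open>The previous lemma sums over sequences, a matrix product over positions; distinctness of
  \<open>index_seqs n k\<close> allows the reindexing.\<close>

lemma has_real_derivative_compound_ode:
  fixes A :: "real mat" and W :: "real \<Rightarrow> real mat"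
  assumes A: "A \<in> carrier_mat n n" and W: "\<And>s. W s \<in> carrier_mat n k"
    and deriv: "\<And>i j. i < n \<Longrightarrow> j < k \<Longrightarrow>
      ((\<lambda>s. W s $$ (i, j)) has_real_derivative (A * W x) $$ (i, j)) (at x within S)"
    and i: "i < n choose k"
  shows "((\<lambda>s. col (mult_compound k (W s)) 0 $ i) has_real_derivative
    (add_compound k A *\<^sub>v col (mult_compound k (W x)) 0) $ i) (at x within S)"
proof -
  have dims: "dim_row (W s) = n" "dim_col (W s) = k" for s
    using W[of s] by auto
  have col: "col (mult_compound k (W s)) 0 $ j = kminor (W s) (index_seqs n k ! j) [0..<k]"
    if "j < n choose k" for j s
    using that by (simp add: mult_compound_def dims index_seqs_self)
  have add: "add_compound k A $$ (i, j) =
      deriv (\<lambda>\<epsilon>. kminor (1\<^sub>m n + \<epsilon> \<cdot>\<^sub>m A) (index_seqs n k ! i) (index_seqs n k ! j)) 0"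
    if "j < n choose k" for j
    using that i A by (simp add: add_compound_def mult_compound_def)
  have dim: "dim_row (mult_compound k (W x)) = n choose k" "dim_row (add_compound k A) = n choose k"
    "dim_col (add_compound k A) = n choose k"
    using A by (simp_all add: mult_compound_def add_compound_def dims)
  have "(\<Sum>J\<in>set (index_seqs n k). deriv (\<lambda>\<epsilon>. kminor (1\<^sub>m n + \<epsilon> \<cdot>\<^sub>m A) (index_seqs n k ! i) J) 0 *
        kminor (W x) J [0..<k]) =
      (\<Sum>j<n choose k. deriv (\<lambda>\<epsilon>. kminor (1\<^sub>m n + \<epsilon> \<cdot>\<^sub>m A) (index_seqs n k ! i) (index_seqs n k ! j)) 0 *
        kminor (W x) (index_seqs n k ! j) [0..<k])"
    by (rule sum.reindex_bij_betw[OF bij_betw_nth[OF distinct_index_seqs], symmetric])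
      (simp_all add: length_index_seqs)
  also have "\<dots> = (add_compound k A *\<^sub>v col (mult_compound k (W x)) 0) $ i"
    using i by (simp add: scalar_prod_def dim lessThan_atLeast0 add col)
  finally have "\<dots> = (\<Sum>J\<in>set (index_seqs n k).
      deriv (\<lambda>\<epsilon>. kminor (1\<^sub>m n + \<epsilon> \<cdot>\<^sub>m A) (index_seqs n k ! i) J) 0 * kminor (W x) J [0..<k])"
    by simp
  then show ?thesis
    using has_real_derivative_kminor_ode[OF A W deriv index_seqs_nth[OF i], where L = "[0..<k]"] i
    by (simp add: col lessThan_atLeast0)
qed

section \<open>Vector norms and matrix measures\<close>

locale vector_norm =
  fixes q :: nat and N :: "real vec \<Rightarrow> real"
  assumes norm: "is_vector_norm q N"
begin

lemma N_nonneg: "x \<in> carrier_vec q \<Longrightarrow> 0 \<le> N x"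
  and N_eq_0: "x \<in> carrier_vec q \<Longrightarrow> N x = 0 \<longleftrightarrow> x = 0\<^sub>v q"
  and N_smult: "x \<in> carrier_vec q \<Longrightarrow> N (c \<cdot>\<^sub>v x) = \<bar>c\<bar> * N x"
  and N_add: "x \<in> carrier_vec q \<Longrightarrow> y \<in> carrier_vec q \<Longrightarrow> N (x + y) \<le> N x + N y"
  using norm by (auto simp: is_vector_norm_def)

lemma N_zero: "N (0\<^sub>v q) = 0"
  by (simp add: N_eq_0)

text \<open>A weighted l1 expression in the coordinates that dominates \<open>N\<close>. It turns
  coordinatewise estimates and limits, the form in which solutions are given, into statements about
  \<open>N\<close>.\<close>

definition weight :: "(nat \<Rightarrow> real) \<Rightarrow> real" where
  "weight f = (\<Sum>i<q. \<bar>f i\<bar> * N (unit_vec q i))"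

lemma weight_mono:
  assumes "\<And>i. i < q \<Longrightarrow> \<bar>f i\<bar> \<le> \<bar>g i\<bar>"
  shows "weight f \<le> weight g"
  unfolding weight_def using assms by (intro sum_mono mult_right_mono) (auto simp: N_nonneg)

lemma N_le_weight: "N (vec q f) \<le> weight f"
proof -
  have "N (vec q (\<lambda>i. if i < m then f i else 0)) \<le> (\<Sum>i<m. \<bar>f i\<bar> * N (unit_vec q i))"
    if "m \<le> q" for m
    using that
  proof (induction m)
    case 0
    have "vec q (\<lambda>i. 0) = (0\<^sub>v q :: real vec)"
      by auto
    then show ?case
      by (simp add: N_zero)
  next
    case (Suc m)
    have "vec q (\<lambda>i. if i < Suc m then f i else 0) =
        vec q (\<lambda>i. if i < m then f i else 0) + f m \<cdot>\<^sub>v unit_vec q m"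
      using Suc.prems by (intro eq_vecI) (auto simp: less_Suc_eq)
    also have "N \<dots> \<le> N (vec q (\<lambda>i. if i < m then f i else 0)) + N (f m \<cdot>\<^sub>v unit_vec q m)"
      by (rule N_add) auto
    also have "\<dots> \<le> (\<Sum>i<m. \<bar>f i\<bar> * N (unit_vec q i)) + \<bar>f m\<bar> * N (unit_vec q m)"
      using Suc by (intro add_mono) (simp_all add: N_smult)
    finally show ?case
      by simp
  qed
  from this[of q] have "N (vec q (\<lambda>i. if i < q then f i else 0)) \<le> weight f"
    by (simp add: weight_def)
  moreover have "vec q (\<lambda>i. if i < q then f i else 0) = vec q f"
    by auto
  ultimately show ?thesis
    by simp
qed

lemma N_diff_le_weight:
  assumes x: "x \<in> carrier_vec q" and y: "y \<in> carrier_vec q"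
  shows "\<bar>N x - N y\<bar> \<le> weight (\<lambda>i. x $ i - y $ i)"
proof -
  have "N u \<le> N v + weight (\<lambda>i. u $ i - v $ i)"
    if "u \<in> carrier_vec q" "v \<in> carrier_vec q" for u v
  proof -
    have "u = v + vec q (\<lambda>i. u $ i - v $ i)"
      using that by (intro eq_vecI) auto
    then have "N u = N (v + vec q (\<lambda>i. u $ i - v $ i))"
      by simp
    also have "\<dots> \<le> N v + N (vec q (\<lambda>i. u $ i - v $ i))"
      using that by (intro N_add) auto
    finally show ?thesis
      using N_le_weight[of "\<lambda>i. u $ i - v $ i"] by linarith
  qed
  from this[OF x y] this[OF y x] show ?thesis
    by (simp add: weight_def abs_minus_commute abs_le_iff)
qed

lemma tendsto_weight_zero:
  assumes "\<And>i. i < q \<Longrightarrow> ((\<lambda>s. f s i) \<longlongrightarrow> 0) F"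
  shows "((\<lambda>s. weight (f s)) \<longlongrightarrow> 0) F"
  unfolding weight_def
  by (intro tendsto_null_sum tendsto_mult_left_zero tendsto_rabs_zero) (auto intro: assms)

lemma tendsto_N:
  assumes "\<And>s. y s \<in> carrier_vec q" "z \<in> carrier_vec q"
    and "\<And>i. i < q \<Longrightarrow> ((\<lambda>s. y s $ i) \<longlongrightarrow> z $ i) F"
  shows "((\<lambda>s. N (y s)) \<longlongrightarrow> N z) F"
proof -
  have "((\<lambda>s. weight (\<lambda>i. y s $ i - z $ i)) \<longlongrightarrow> 0) F"
    using assms(3) by (intro tendsto_weight_zero) (simp add: LIM_zero)
  then have "((\<lambda>s. N (y s) - N z) \<longlongrightarrow> 0) F"
    by (rule Lim_null_comparison[rotated])
      (intro always_eventually allI, simp add: N_diff_le_weight assms)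
  then show ?thesis
    by (rule LIM_zero_cancel)
qed

text \<open>Half of the equivalence of norms: for \<open>q > 0\<close>, \<open>c\<close> is the
  minimum of \<open>N\<close> on the l1 unit sphere, positive since \<open>N\<close> vanishes only
  at zero.\<close>

lemma N_lower_bound:
  obtains c where "c > 0" "\<And>x. x \<in> carrier_vec q \<Longrightarrow> c * (\<Sum>i<q. \<bar>x $ i\<bar>) \<le> N x"
proof (cases "q = 0")
  case True
  then show ?thesis
    by (intro that[of 1]) (auto intro: N_nonneg)
next
  case False
  \<comment> \<open>The sphere is placed in the function space \<open>nat \<Rightarrow> real\<close>
    with the product topology. Pinning the coordinates from \<open>q\<close> on to \<open>0\<close>
    makes the surrounding box compact by Tychonoff.\<close>
  define K where "K = Pi\<^sub>E UNIV (\<lambda>i. if i < q then {-1..1} else {0 :: real}) \<inter> {f. (\<Sum>i<q. \<bar>f i\<bar>) = 1}"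
  have "compact (Pi\<^sub>E UNIV (\<lambda>i. if i < q then {-1..1} else {0}) :: (nat \<Rightarrow> real) set)"
    by (subst compactin_euclidean_iff[symmetric], subst euclidean_product_topology[symmetric],
        subst compactin_PiE) simp
  moreover have "closed {f :: nat \<Rightarrow> real. (\<Sum>i<q. \<bar>f i\<bar>) = 1}"
    by (intro closed_Collect_eq continuous_intros continuous_on_product_coordinates)
  ultimately have "compact K"
    unfolding K_def by (rule compact_Int_closed)
  moreover have "(\<lambda>i. if i = 0 then 1 else 0) \<in> K"
    using False by (auto simp: K_def if_distrib[of abs] cong: if_cong)
  moreover have "continuous_on K (\<lambda>f. N (vec q f))"
    unfolding continuous_on_def
  proof (intro ballI tendsto_N)
    fix f :: "nat \<Rightarrow> real" and i assume "i < q"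
    have "((\<lambda>g. g i) \<longlongrightarrow> f i) (at f within K)"
      using continuous_on_product_coordinates[of i]
      by (metis UNIV_I continuous_on_def continuous_on_subset subset_UNIV tendsto_within_subset)
    then show "((\<lambda>g. vec q g $ i) \<longlongrightarrow> vec q f $ i) (at f within K)"
      using \<open>i < q\<close> by simp
  qed auto
  ultimately obtain f where f: "f \<in> K" and min: "\<And>g. g \<in> K \<Longrightarrow> N (vec q f) \<le> N (vec q g)"
    using continuous_attains_inf[of K] by blast
  have "vec q f \<noteq> 0\<^sub>v q"
  proof
    assume "vec q f = 0\<^sub>v q"
    then have "\<forall>i<q. f i = 0"
      by (metis index_vec index_zero_vec(1))
    then show False
      using f by (simp add: K_def)
  qed
  then have pos: "N (vec q f) > 0"
    using N_nonneg[of "vec q f"] N_eq_0[of "vec q f"] by fastforce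
  show ?thesis
  proof (rule that[OF pos])
    fix x :: "real vec" assume x: "x \<in> carrier_vec q"
    define s where "s = (\<Sum>i<q. \<bar>x $ i\<bar>)"
    show "N (vec q f) * (\<Sum>i<q. \<bar>x $ i\<bar>) \<le> N x"
    proof (cases "s = 0")
      case True
      then show ?thesis
        using N_nonneg[OF x] by (simp add: s_def)
    next
      case False
      then have s: "s > 0"
        by (simp add: s_def sum_nonneg less_le)
      have le: "\<bar>x $ i\<bar> \<le> s" if "i < q" for i
        unfolding s_def using that by (intro member_le_sum) auto
      define g where "g i = (if i < q then x $ i / s else 0)" for i
      have "(\<Sum>i<q. \<bar>g i\<bar>) = (\<Sum>i<q. \<bar>x $ i\<bar> / s)"
        using s by (intro sum.cong) (simp_all add: g_def)
      also have "\<dots> = 1"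
        using s by (simp add: s_def flip: sum_divide_distrib)
      finally have "g \<in> K"
        using s le by (force simp: K_def g_def abs_le_iff field_simps)
      then have "N (vec q f) * s \<le> N (vec q g) * s"
        using min s by (intro mult_right_mono) auto
      also have "N (vec q g) * s = N (s \<cdot>\<^sub>v vec q g)"
        using s by (simp add: N_smult)
      also have "s \<cdot>\<^sub>v vec q g = x"
        using x s by (intro eq_vecI) (auto simp: g_def)
      finally show ?thesis
        by (simp add: s_def)
    qed
  qed
qed

text \<open>Where \<open>N x = 1\<close>, the lower bound confines each coordinate of
  \<open>x\<close> to \<open>1 / c\<close> in absolute value, and \<open>weight\<close> then bounds
  the image.\<close>

lemma bdd_above_induced_norm:
  assumes M: "M \<in> carrier_mat q q"
  shows "bdd_above ((\<lambda>x. N (M *\<^sub>v x)) ` {x \<in> carrier_vec q. N x = 1})"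
proof -
  obtain c where c: "c > 0" "\<And>x. x \<in> carrier_vec q \<Longrightarrow> c * (\<Sum>i<q. \<bar>x $ i\<bar>) \<le> N x"
    using N_lower_bound by blast
  have "N (M *\<^sub>v x) \<le> weight (\<lambda>i. \<Sum>j<q. \<bar>M $$ (i, j)\<bar> / c)"
    if x: "x \<in> carrier_vec q" "N x = 1" for x
  proof -
    have le: "\<bar>x $ j\<bar> \<le> 1 / c" if "j < q" for j
    proof -
      have "\<bar>x $ j\<bar> \<le> (\<Sum>i<q. \<bar>x $ i\<bar>)"
        using that by (intro member_le_sum) auto
      also have "\<dots> \<le> 1 / c"
        using c(2)[OF x(1)] c(1) x(2) by (simp add: field_simps)
      finally show ?thesis .
    qed
    have "M *\<^sub>v x = vec q (\<lambda>i. \<Sum>j<q. M $$ (i, j) * x $ j)"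
      using M x by (intro eq_vecI) (auto simp: scalar_prod_def lessThan_atLeast0)
    also have "N \<dots> \<le> weight (\<lambda>i. \<Sum>j<q. M $$ (i, j) * x $ j)"
      by (rule N_le_weight)
    also have "\<dots> \<le> weight (\<lambda>i. \<Sum>j<q. \<bar>M $$ (i, j)\<bar> / c)"
    proof (rule weight_mono)
      fix i
      have "\<bar>\<Sum>j<q. M $$ (i, j) * x $ j\<bar> \<le> (\<Sum>j<q. \<bar>M $$ (i, j) * x $ j\<bar>)"
        by (rule sum_abs)
      also have "\<dots> \<le> (\<Sum>j<q. \<bar>M $$ (i, j)\<bar> / c)"
        using mult_left_mono[OF le abs_ge_zero] by (intro sum_mono) (simp add: abs_mult)
      finally show "\<bar>\<Sum>j<q. M $$ (i, j) * x $ j\<bar> \<le> \<bar>\<Sum>j<q. \<bar>M $$ (i, j)\<bar> / c\<bar>"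
        by linarith
    qed
    finally show ?thesis .
  qed
  then show ?thesis
    by (intro bdd_aboveI2) auto
qed

lemma N_mult_le:
  assumes M: "M \<in> carrier_mat q q" and x: "x \<in> carrier_vec q"
  shows "N (M *\<^sub>v x) \<le> induced_norm q N M * N x"
proof (cases "N x = 0")
  case True
  then have "x = 0\<^sub>v q"
    using x by (simp add: N_eq_0)
  moreover have "M *\<^sub>v 0\<^sub>v q = 0\<^sub>v q"
    using M by auto
  ultimately show ?thesis
    by (simp add: N_zero)
next
  case False
  then have pos: "N x > 0"
    using N_nonneg[OF x] by simp
  let ?u = "(1 / N x) \<cdot>\<^sub>v x"
  have "N (M *\<^sub>v ?u) \<le> induced_norm q N M"
    unfolding induced_norm_def
    using x pos by (intro cSUP_upper bdd_above_induced_norm M) (auto simp: N_smult)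
  also have "M *\<^sub>v ?u = (1 / N x) \<cdot>\<^sub>v (M *\<^sub>v x)"
    using M x by (rule mult_mat_vec)
  finally show ?thesis
    using pos M x by (simp add: N_smult field_simps)
qed

end

text \<open>For \<open>q = 0\<close> the unit sphere is empty and a supremum over it says nothing;
  \<open>0 < q\<close> excludes this.\<close>

locale nontrivial_vector_norm = vector_norm +
  assumes q_pos: "0 < q"
begin

lemma unit_sphere_nonempty: "\<exists>x \<in> carrier_vec q. N x = 1"
proof -
  let ?e = "unit_vec q 0"
  have "?e \<noteq> (0\<^sub>v q :: real vec)"
    using q_pos by (metis index_unit_vec(2) index_zero_vec(1) zero_neq_one)
  then have "N ?e > 0"
    using N_nonneg[of ?e] N_eq_0[of ?e] by fastforce
  then show ?thesis
    by (intro bexI[of _ "(1 / N ?e) \<cdot>\<^sub>v ?e"]) (simp_all add: N_smult)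
qed

text \<open>The difference quotient decreases as \<open>\<epsilon>\<close> decreases to \<open>0\<close>, by convexity of the norm.\<close>

lemma tendsto_matrix_measure:
  assumes M: "M \<in> carrier_mat q q"
  shows "((\<lambda>\<epsilon>. (induced_norm q N (1\<^sub>m q + \<epsilon> \<cdot>\<^sub>m M) - 1) / \<epsilon>) \<longlongrightarrow> matrix_measure q N M) (at_right 0)"
proof -
  let ?P = "\<lambda>\<epsilon>. 1\<^sub>m q + \<epsilon> \<cdot>\<^sub>m M"
  let ?Q = "\<lambda>\<epsilon>. (induced_norm q N (?P \<epsilon>) - 1) / \<epsilon>"
  have P: "?P \<epsilon> \<in> carrier_mat q q" for \<epsilon>
    using M by simp
  have Px: "?P \<epsilon> *\<^sub>v x = x + \<epsilon> \<cdot>\<^sub>v (M *\<^sub>v x)" if "x \<in> carrier_vec q" for x \<epsilon>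
    using M that
    by (subst add_mult_distrib_mat_vec[of _ q q]) (auto intro!: eq_vecI)
  have Px_carrier: "?P \<epsilon> *\<^sub>v x \<in> carrier_vec q" if "x \<in> carrier_vec q" for x \<epsilon>
    using P that by (rule mult_mat_vec_carrier)
  have mono: "?Q a \<le> ?Q b" if "0 < a" "a \<le> b" for a b
  proof -
    have "induced_norm q N (?P a) \<le> 1 - a / b + a / b * induced_norm q N (?P b)"
      unfolding induced_norm_def[of _ _ "?P a"]
    proof (rule cSUP_least)
      fix x assume "x \<in> {x \<in> carrier_vec q. N x = 1}"
      then have x: "x \<in> carrier_vec q" "N x = 1"
        by auto
      \<comment> \<open>\<open>I + a M\<close> is the convex combination of \<open>I\<close> and
        \<open>I + b M\<close> with weights \<open>1 - a / b\<close> and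
        \<open>a / b\<close>.\<close>
      have "?P a *\<^sub>v x = (1 - a / b) \<cdot>\<^sub>v x + (a / b) \<cdot>\<^sub>v (?P b *\<^sub>v x)"
        unfolding Px[OF x(1)] using x M that by (intro eq_vecI) (auto simp: field_simps)
      also have "N \<dots> \<le> N ((1 - a / b) \<cdot>\<^sub>v x) + N ((a / b) \<cdot>\<^sub>v (?P b *\<^sub>v x))"
        using x Px_carrier by (intro N_add) auto
      also have "\<dots> = 1 - a / b + a / b * N (?P b *\<^sub>v x)"
        using x Px_carrier that by (simp add: N_smult)
      also have "\<dots> \<le> 1 - a / b + a / b * induced_norm q N (?P b)"
        using N_mult_le[OF P x(1), of b] x(2) that by (intro add_left_mono mult_left_mono) auto
      finally show "N (?P a *\<^sub>v x) \<le> 1 - a / b + a / b * induced_norm q N (?P b)" .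
    qed (use unit_sphere_nonempty in auto)
    also have "1 - a / b + a / b * induced_norm q N (?P b) = 1 + ?Q b * a"
      using that by (simp add: field_simps)
    finally show ?thesis
      using that by (simp add: pos_divide_le_eq)
  qed
  \<comment> \<open>A unit vector \<open>x\<close> equals \<open>(I + a M) x - a M x\<close>, so
    \<open>1\<close> is at most the norm of \<open>I + a M\<close> plus \<open>a\<close> times the
    norm of \<open>M\<close>.\<close>
  have bound: "- induced_norm q N M \<le> ?Q a" if "0 < a" for a
  proof -
    obtain x where x: "x \<in> carrier_vec q" "N x = 1"
      using unit_sphere_nonempty by blast
    have Mx: "M *\<^sub>v x \<in> carrier_vec q"
      using M x by auto
    have "x = ?P a *\<^sub>v x + (- a) \<cdot>\<^sub>v (M *\<^sub>v x)"
      unfolding Px[OF x(1)] using x M by (intro eq_vecI) auto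
    then have "N x \<le> N (?P a *\<^sub>v x) + N ((- a) \<cdot>\<^sub>v (M *\<^sub>v x))"
      using N_add[of "?P a *\<^sub>v x" "(- a) \<cdot>\<^sub>v (M *\<^sub>v x)"] P[of a] x Mx by simp
    also have "\<dots> \<le> induced_norm q N (?P a) + a * induced_norm q N M"
      using N_mult_le[OF P x(1), of a] N_mult_le[OF M x(1)] x(2) that Mx
      by (simp add: N_smult add_mono)
    finally show ?thesis
      using x(2) that by (simp add: field_simps)
  qed
  have bdd: "bdd_below (?Q ` {0<..})"
    using bound by (intro bdd_belowI2) auto
  \<comment> \<open>Being monotone and bounded below, the quotient tends to its infimum; only then
    does \<open>Lim\<close> denote this value.\<close>
  define L where "L = (INF \<epsilon>\<in>{0<..}. ?Q \<epsilon>)"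
  have "(?Q \<longlongrightarrow> L) (at_right 0)"
  proof (rule order_tendstoI)
    fix a assume "a < L"
    have "\<forall>\<^sub>F \<epsilon> in at_right 0. \<epsilon> > (0 :: real)"
      by (rule eventually_at_right_less)
    then show "\<forall>\<^sub>F \<epsilon> in at_right 0. a < ?Q \<epsilon>"
    proof eventually_elim
      case (elim \<epsilon>)
      then have "L \<le> ?Q \<epsilon>"
        unfolding L_def by (intro cINF_lower bdd) auto
      then show ?case
        using \<open>a < L\<close> by simp
    qed
  next
    fix a assume "L < a"
    then obtain b where b: "b > 0" "?Q b < a"
      unfolding L_def using bdd by (subst (asm) cINF_less_iff) auto
    show "\<forall>\<^sub>F \<epsilon> in at_right 0. ?Q \<epsilon> < a"
      unfolding eventually_at_right_field
      using b by (intro exI[of _ b]) (auto intro: le_less_trans[OF mono[OF _ less_imp_le]])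
  qed
  moreover from this have "matrix_measure q N M = L"
    unfolding matrix_measure_def by (rule tendsto_Lim[rotated]) simp
  ultimately show ?thesis
    by simp
qed

end

section \<open>Decay of the norm\<close>

text \<open>For a slope \<open>d > 0\<close>, let \<open>c\<close> be the last time in
  \<open>{0..T}\<close> at which \<open>U\<close> is on or below the line
  \<open>U 0 + d * t\<close>. If \<open>c < T\<close>, the Dini bound with \<open>e = d\<close>
  yields a later such time, so \<open>c = T\<close>; then \<open>d\<close> may be taken arbitrarily
  small.\<close>

lemma nonincreasing_if_upper_right_Dini_nonpos:
  fixes U :: "real \<Rightarrow> real"
  assumes cont: "continuous_on {0..} U"
    and dini: "\<And>t e. 0 \<le> t \<Longrightarrow> 0 < e \<Longrightarrow> \<forall>\<^sub>F h in at_right 0. U (t + h) \<le> U t + e * h"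
    and T: "0 \<le> T"
  shows "U T \<le> U 0"
proof (rule field_le_epsilon)
  fix e :: real assume "0 < e"
  \<comment> \<open>Chosen so that \<open>d * T \<le> e\<close>; the \<open>+ 1\<close> covers
    \<open>T = 0\<close>.\<close>
  define d where "d = e / (T + 1)"
  have d: "0 < d"
    using \<open>0 < e\<close> T by (simp add: d_def)
  have "U T \<le> U 0 + d * T"
  proof (rule ccontr)
    assume contra: "\<not> U T \<le> U 0 + d * T"
    define g where "g t = U t - U 0 - d * t" for t
    define Z where "Z = {0..T} \<inter> g -` {..0}"
    have "continuous_on {0..T} g"
      unfolding g_def by (intro continuous_intros continuous_on_subset[OF cont]) auto
    then have "closed Z"
      unfolding Z_def by (rule continuous_closed_preimage) auto
    then have "compact ({0..T} \<inter> Z)"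
      by (rule compact_Int_closed[OF compact_Icc])
    also have "{0..T} \<inter> Z = Z"
      by (auto simp: Z_def)
    finally have "compact Z" .
    moreover have "0 \<in> Z"
      using T by (simp add: Z_def g_def)
    ultimately obtain c where c: "c \<in> Z" "\<And>t. t \<in> Z \<Longrightarrow> t \<le> c"
      using compact_attains_sup[of Z] by blast
    have "c < T"
      using c contra by (cases "c = T") (auto simp: Z_def g_def)
    then have "\<forall>\<^sub>F h in at_right 0. h < T - c"
      unfolding eventually_at_right_field by (intro exI[of _ "T - c"]) auto
    moreover have "\<forall>\<^sub>F h in at_right 0. U (c + h) \<le> U c + d * h"
      using dini[of c d] c(1) d by (simp add: Z_def)
    ultimately have "\<forall>\<^sub>F h in at_right 0. 0 < h \<and> h < T - c \<and> U (c + h) \<le> U c + d * h"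
      by (intro eventually_conj eventually_at_right_less)
    then obtain h where h: "0 < h" "h < T - c" "U (c + h) \<le> U c + d * h"
      using eventually_happens[of _ "at_right (0 :: real)"] by auto
    then have "c + h \<in> Z"
      using c(1) by (auto simp: Z_def g_def algebra_simps)
    then show False
      using c(2) h(1) by fastforce
  qed
  also have "d * T \<le> e"
    using \<open>0 < e\<close> T by (simp add: d_def field_simps)
  finally show "U T \<le> U 0 + e"
    by simp
qed

context nontrivial_vector_norm
begin

lemma coppel_inequality:
  assumes y: "\<And>s. y s \<in> carrier_vec q"
    and B: "\<And>t. 0 \<le> t \<Longrightarrow> B t \<in> carrier_mat q q"
    and deriv: "\<And>t i. 0 \<le> t \<Longrightarrow> i < q \<Longrightarrow>
      ((\<lambda>s. y s $ i) has_real_derivative (B t *\<^sub>v y t) $ i) (at t within {0..})"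
    and measure: "\<And>t. 0 \<le> t \<Longrightarrow> matrix_measure q N (B t) \<le> - \<eta>"
    and T: "0 \<le> T"
  shows "N (y T) \<le> exp (- \<eta> * T) * N (y 0)"
proof -
  define U where "U t = exp (\<eta> * t) * N (y t)" for t
  have "continuous_on {0..} (\<lambda>t. N (y t))"
    unfolding continuous_on_def
  proof (intro ballI tendsto_N y)
    fix t :: real and i assume "t \<in> {0..}" "i < q"
    then have "continuous (at t within {0..}) (\<lambda>s. y s $ i)"
      using deriv[of t i] by (intro DERIV_continuous) simp
    then show "((\<lambda>s. y s $ i) \<longlongrightarrow> y t $ i) (at t within {0..})"
      by (simp add: continuous_within)
  qed
  then have cont: "continuous_on {0..} U"
    unfolding U_def by (intro continuous_intros)
  have dini: "\<forall>\<^sub>F h in at_right 0. U (t + h) \<le> U t + e * h" if t: "0 \<le> t" and e: "0 < e" for t e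
  proof -
    let ?P = "\<lambda>h. 1\<^sub>m q + h \<cdot>\<^sub>m B t"
    let ?Q = "\<lambda>h. (induced_norm q N (?P h) - 1) / h"
    let ?\<rho> = "\<lambda>h i. (y (t + h) $ i - y t $ i) / h - (B t *\<^sub>v y t) $ i"
    let ?\<mu> = "matrix_measure q N (B t)"
    \<comment> \<open>\<open>?\<rho> h\<close> is the error of the difference quotient of
      \<open>y\<close>, vanishing in each coordinate as \<open>h\<close> tends to \<open>0\<close>.
      \<open>E h\<close> bounds the right difference quotient of \<open>N (y t)\<close> and, unlike
      that quotient, has an evident limit.\<close>
    define E where "E h = ?Q h * N (y t) + weight (?\<rho> h)" for h
    have step: "N (y (t + h)) \<le> N (y t) + h * E h" if h: "0 < h" for h
    proof -
      have P: "?P h \<in> carrier_mat q q"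
        using B[OF t] by simp
      have "?P h *\<^sub>v y t = y t + h \<cdot>\<^sub>v (B t *\<^sub>v y t)"
        using B[OF t] y[of t]
        by (subst add_mult_distrib_mat_vec[of _ q q]) (auto intro!: eq_vecI)
      then have "y (t + h) = ?P h *\<^sub>v y t + h \<cdot>\<^sub>v vec q (?\<rho> h)"
        using y[of t] y[of "t + h"] carrier_matD[OF B[OF t]] h
        by (intro eq_vecI) (auto simp: field_simps)
      then have "N (y (t + h)) \<le> N (?P h *\<^sub>v y t) + N (h \<cdot>\<^sub>v vec q (?\<rho> h))"
        using N_add[OF mult_mat_vec_carrier[OF P y[of t]], of "h \<cdot>\<^sub>v vec q (?\<rho> h)"] by simp
      also have "\<dots> \<le> induced_norm q N (?P h) * N (y t) + h * weight (?\<rho> h)"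
        using N_mult_le[OF P y] N_le_weight h by (intro add_mono) (simp_all add: N_smult)
      also have "\<dots> = N (y t) + h * E h"
        using h by (simp add: E_def field_simps)
      finally show ?thesis .
    qed
    have "((\<lambda>h. weight (?\<rho> h)) \<longlongrightarrow> 0) (at_right 0)"
    proof (rule tendsto_weight_zero)
      fix i assume "i < q"
      have "((\<lambda>s. y s $ i) has_real_derivative (B t *\<^sub>v y t) $ i) (at_right t)"
        by (rule has_field_derivative_subset[OF deriv[OF t \<open>i < q\<close>]]) (use t in auto)
      then have "((\<lambda>h. (y (h + t) $ i - y t $ i) / h) \<longlongrightarrow> (B t *\<^sub>v y t) $ i) (at_right 0)"
        by (simp add: has_field_derivative_iff filterlim_at_right_to_0[of _ _ t])
      then show "((\<lambda>h. ?\<rho> h i) \<longlongrightarrow> 0) (at_right 0)"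
        by (simp add: add.commute LIM_zero)
    qed
    then have "(E \<longlongrightarrow> ?\<mu> * N (y t) + 0) (at_right 0)"
      unfolding E_def by (intro tendsto_add tendsto_mult_right tendsto_matrix_measure B t)
    then have E: "(E \<longlongrightarrow> ?\<mu> * N (y t)) (at_right 0)"
      by simp
    have "((\<lambda>h. (exp (\<eta> * h) - 1) / h) \<longlongrightarrow> \<eta>) (at_right 0)"
    proof -
      have "((\<lambda>h. exp (\<eta> * h)) has_real_derivative \<eta>) (at_right 0)"
        by (auto intro!: derivative_eq_intros)
      then show ?thesis
        by (simp add: has_field_derivative_iff)
    qed
    moreover have "((\<lambda>h. exp (\<eta> * h)) \<longlongrightarrow> 1) (at_right 0)"
      by (auto intro!: tendsto_eq_intros)
    \<comment> \<open>An upper bound for the difference quotient of \<open>U\<close>, in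
      product-rule form with \<open>E h\<close> in place of the quotient of the norm. Its limit is
      nonpositive because \<open>\<eta> + ?\<mu> \<le> 0\<close>, hence below
      \<open>e\<close>.\<close>
    ultimately have "((\<lambda>h. exp (\<eta> * t) * ((exp (\<eta> * h) - 1) / h * N (y t) + exp (\<eta> * h) * E h))
        \<longlongrightarrow> exp (\<eta> * t) * (\<eta> * N (y t) + 1 * (?\<mu> * N (y t)))) (at_right 0)"
      by (intro tendsto_intros E)
    moreover have "exp (\<eta> * t) * (\<eta> * N (y t) + 1 * (?\<mu> * N (y t))) < e"
    proof -
      have "(\<eta> + ?\<mu>) * N (y t) \<le> 0"
        using measure[OF t] N_nonneg[OF y] by (intro mult_nonpos_nonneg) auto
      then have "exp (\<eta> * t) * ((\<eta> + ?\<mu>) * N (y t)) \<le> 0"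
        by (rule mult_nonneg_nonpos[OF exp_ge_zero])
      then show ?thesis
        using e by (simp add: algebra_simps)
    qed
    ultimately have "\<forall>\<^sub>F h in at_right 0.
        exp (\<eta> * t) * ((exp (\<eta> * h) - 1) / h * N (y t) + exp (\<eta> * h) * E h) < e"
      by (rule order_tendstoD)
    moreover have "\<forall>\<^sub>F h in at_right 0. (0 :: real) < h"
      by (rule eventually_at_right_less)
    ultimately show ?thesis
    proof eventually_elim
      case (elim h)
      have "U (t + h) \<le> exp (\<eta> * (t + h)) * (N (y t) + h * E h)"
        unfolding U_def using step elim by (intro mult_left_mono) auto
      also have "\<dots> = U t +
          exp (\<eta> * t) * ((exp (\<eta> * h) - 1) / h * N (y t) + exp (\<eta> * h) * E h) * h"
        using elim by (simp add: U_def exp_add field_simps)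
      also have "\<dots> \<le> U t + e * h"
        using elim by (intro add_left_mono mult_right_mono) auto
      finally show ?case .
    qed
  qed
  have "U T \<le> U 0"
    using cont dini T by (rule nonincreasing_if_upper_right_Dini_nonpos)
  then show ?thesis
    by (simp add: U_def exp_minus field_simps)
qed

end

theorem theorem4:
  fixes n k r :: nat and A :: "real \<Rightarrow> real mat"
  assumes "1 \<le> n" and "k \<in> {1..n}" and "r = n choose k"
    and "\<forall>t \<ge> 0. A t \<in> carrier_mat n n"
    and "\<forall>i < n. \<forall>j < n. continuous_on {0..} (\<lambda>t. A t $$ (i, j))"
    and "\<exists>\<eta> N. 0 < \<eta> \<and> is_vector_norm r N \<and>
           (\<forall>t \<ge> 0. matrix_measure r N (add_compound k (A t)) \<le> - \<eta>)"
  shows "k_contractive n k A"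
proof -
  note A = assms(4)[rule_format]
  obtain \<eta> N where \<eta>: "0 < \<eta>" and N: "is_vector_norm (n choose k) N"
    and \<mu>: "\<And>t. 0 \<le> t \<Longrightarrow> matrix_measure (n choose k) N (add_compound k (A t)) \<le> - \<eta>"
    using assms(6) unfolding assms(3) by blast
  \<comment> \<open>\<open>k \<le> n\<close> makes the dimension \<open>n choose k\<close>
    positive.\<close>
  interpret nontrivial_vector_norm "n choose k" N
    using N assms(2) by unfold_locales (simp_all add: zero_less_binomial)
  show ?thesis
    unfolding k_contractive_def Let_def
  proof (intro exI conjI allI impI)
    show "0 < \<eta>" "is_vector_norm (n choose k) N"
      by (rule \<eta> N)+
    fix a w t
    assume "\<forall>j<k. a j \<in> carrier_vec n \<and> is_solution n A (a j) (w j)" and "0 \<le> (t :: real)"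
    then have sol: "is_solution n A (a j) (w j)" if "j < k" for j
      using that by blast
    let ?W = "\<lambda>t. mat n k (\<lambda>(i, j). w j t $ i)"
    show "N (col (mult_compound k (?W t)) 0) \<le> exp (- \<eta> * t) * N (col (mult_compound k (?W 0)) 0)"
    proof (rule coppel_inequality[where B = "\<lambda>t. add_compound k (A t)"])
      \<comment> \<open>\<open>mat n k\<close> fixes the dimensions at every \<open>s\<close>,
        including negative times, where solutions are unconstrained.\<close>
      show "col (mult_compound k (?W s)) 0 \<in> carrier_vec (n choose k)" for s
        by (rule carrier_vecI) (simp add: mult_compound_def)
      show "add_compound k (A s) \<in> carrier_mat (n choose k) (n choose k)" if "0 \<le> s" for s
        using A[OF that] by (simp add: add_compound_def)
      show "((\<lambda>s. col (mult_compound k (?W s)) 0 $ i) has_real_derivative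
          (add_compound k (A s) *\<^sub>v col (mult_compound k (?W s)) 0) $ i) (at s within {0..})"
        if "0 \<le> s" "i < n choose k" for s i
      proof (rule has_real_derivative_compound_ode[OF A[OF \<open>0 \<le> s\<close>] _ _ \<open>i < n choose k\<close>])
        fix i j assume ij: "i < n" "j < k"
        have "w j s \<in> carrier_vec n"
          using sol[OF \<open>j < k\<close>] \<open>0 \<le> s\<close> unfolding is_solution_def by blast
        \<comment> \<open>Hence column \<open>j\<close> of \<open>A s * ?W s\<close> is
          \<open>A s\<close> applied to the \<open>j\<close>th solution.\<close>
        then have "col (?W s) j = w j s"
          using ij by (intro eq_vecI) auto
        then have eq: "(A s * ?W s) $$ (i, j) = (A s *\<^sub>v w j s) $ i"
          using ij carrier_matD[OF A[OF \<open>0 \<le> s\<close>]] by (simp del: col_mat)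
        have "((\<lambda>s. w j s $ i) has_real_derivative (A s *\<^sub>v w j s) $ i) (at s within {0..})"
          using sol[OF \<open>j < k\<close>] \<open>0 \<le> s\<close> ij unfolding is_solution_def by blast
        then show "((\<lambda>s. ?W s $$ (i, j)) has_real_derivative (A s * ?W s) $$ (i, j)) (at s within {0..})"
          unfolding eq using ij by simp
      qed simp
    qed (use \<mu> \<open>0 \<le> t\<close> in auto)
  qed
qed

end
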